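(* Let $\mathcal{A}$ be a $p\times q$ matrix of formal power series in $\mathbb{R}[[x]]$. Then (a) $\mathrm{Lace}(\mathcal{A}^\perp) = \mathrm{Lace}(\mathcal{A})^\perp$; (b) $\mathcal{A}^\perp$ is fully interlacing if and only if $\mathcal{A}$ is fully interlacing.
   Context: A $\mathbb{Z}\times\mathbb{Z}$ real matrix is totally positive (TP) if every finite square submatrix has nonnegative determinant. For a $p\times q$ matrix $\mathcal{A} = (A_{ij}(x))_{0\le i<p,\,0\le j<q}$ of formal power series $A_{ij}(x) = \sum_{n\ge 0} a_{ij}(n)x^n$ (with $a_{ij}(n) = 0$ for $n<0$), $\mathrm{Lace}(\mathcal{A}) = (M_{uv})_{u,v\in\mathbb{Z}}$ is defined by writing $u = pu'+i$, $v = qv'+j$ with $u',v'\in\mathbb{Z}$, $0\le i<p$, $0\le j<q$, and setting $M_{uv} = a_{ij}(v'-u')$. $\mathcal{A}$ is fully interlacing if $\mathrm{Lace}(\mathcal{A})$ is TP. The flip $\mathcal{A}^\perp$ of the $p\times q$ matrix $\mathcal{A}$ is the $q\times p$ matrix $(A^\perp_{ji}(x))_{0\le j<q,\,0\le i<p}$ with $A^\perp_{ji}(x) = A_{p-1-i,\,q-1-j}(x)$ (reflection across the reverse diagonal). The flip of a $\mathbb{Z}\times\mathbb{Z}$ matrix $M=(M_{uv})$ is the $\mathbb{Z}\times\mathbb{Z}$ matrix $M^\perp$ with $M^\perp_{vu} = M_{-1-u,\,-1-v}$ for all $u,v\in\mathbb{Z}$. *)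

theory Defs
  imports "Jordan_Normal_Form.Determinant" "HOL-Computational_Algebra.Formal_Power_Series"
begin

(* A submatrix is given by its row and column indices listed in increasing order. *)
definition totally_positive :: "(int \<Rightarrow> int \<Rightarrow> real) \<Rightarrow> bool" where
  "totally_positive M \<longleftrightarrow>
     (\<forall>(n::nat) (r::nat \<Rightarrow> int) (c::nat \<Rightarrow> int).
        strict_mono_on {..<n} r \<longrightarrow> strict_mono_on {..<n} c \<longrightarrow>
        0 \<le> det (mat n n (\<lambda>(k, l). M (r k) (c l))))"

definition fps_coeff_int :: "real fps \<Rightarrow> int \<Rightarrow> real" where
  "fps_coeff_int f n = (if n < 0 then 0 else fps_nth f (nat n))"

(* With p rows and q columns, writing u = p u' + i and v = q v' + j amounts to
   u' = u div p, i = u mod p, v' = v div q, j = v mod q (floor division on int, p, q > 0). *)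
definition lace :: "real fps mat \<Rightarrow> int \<Rightarrow> int \<Rightarrow> real" where
  "lace A u v =
     (let p = int (dim_row A); q = int (dim_col A)
      in fps_coeff_int (A $$ (nat (u mod p), nat (v mod q))) (v div q - u div p))"

lemma lace_decomp:
  assumes "A \<in> carrier_mat p q" "i < p" "j < q"
  shows "lace A (int p * u' + int i) (int q * v' + int j) = fps_coeff_int (A $$ (i, j)) (v' - u')"
  using assms by (simp add: lace_def Let_def)

definition fully_interlacing :: "real fps mat \<Rightarrow> bool" where
  "fully_interlacing A \<longleftrightarrow> totally_positive (lace A)"

definition flip_mat :: "'a mat \<Rightarrow> 'a mat" where
  "flip_mat A = mat (dim_col A) (dim_row A)
     (\<lambda>(j, i). A $$ (dim_row A - 1 - i, dim_col A - 1 - j))"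

definition flip_int :: "(int \<Rightarrow> int \<Rightarrow> 'a) \<Rightarrow> int \<Rightarrow> int \<Rightarrow> 'a" where
  "flip_int M v u = M (- 1 - u) (- 1 - v)"

end

theory Submission
  imports Defs
begin

text \<open>The reflection \<open>u\<close> to \<open>-1 - u\<close> of the integers reverses both
  the block index and the residue within a block. On residues this is the flip of a finite matrix;
  on block indices the constants cancel in the difference that selects the coefficient. This gives
  the identity of laces (\<open>lace_flip_mat\<close>). For positivity, each minor of a flipped
  matrix is the determinant of a flipped submatrix of the original, and \<open>det_flip_mat\<close>
  shows that flipping preserves determinants. Since the flip is an involution, the equivalence
  follows.\<close>

text \<open>The flip is a row reversal, a transposition and another row reversal; the two reversals
  contribute the same sign.\<close>

lemma det_flip_mat:
  fixes A :: "'a :: comm_ring_1 mat"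
  assumes A: "A \<in> carrier_mat n n"
  shows "det (flip_mat A) = det A"
proof -
  \<comment> \<open>The identity branch outside the index range is what \<open>permutes\<close>
    demands.\<close>
  define \<rho> where "\<rho> = (\<lambda>i. if i < n then n - 1 - i else i)"
  define R where "R = (\<lambda>B :: 'a mat. mat n n (\<lambda>(i, j). B $$ (\<rho> i, j)))"
  have "bij_betw \<rho> {0..<n} {0..<n}"
    by (rule bij_betw_byWitness[where f' = \<rho>]) (auto simp: \<rho>_def)
  then have perm: "\<rho> permutes {0..<n}"
    by (rule bij_imp_permutes) (simp add: \<rho>_def)
  have R: "R B \<in> carrier_mat n n" for B
    by (simp add: R_def)
  have detR: "det (R B) = signof \<rho> * det B" if "B \<in> carrier_mat n n" for B
    unfolding R_def by (rule det_permute_rows[OF that perm])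
  have "flip_mat A = R (transpose_mat (R A))"
    using A by (intro eq_matI) (auto simp: flip_mat_def R_def \<rho>_def)
  also have "det \<dots> = signof \<rho> * (signof \<rho> * det A)"
    using A R[of A] by (simp add: detR det_transpose)
  also have "\<dots> = det A"
    by (simp add: sign_def)
  finally show ?thesis .
qed

lemma totally_positive_flip_int:
  assumes "totally_positive M"
  shows "totally_positive (flip_int M)"
  unfolding totally_positive_def
proof (intro allI impI)
  fix n :: nat and r c :: "nat \<Rightarrow> int"
  assume r: "strict_mono_on {..<n} r" and c: "strict_mono_on {..<n} c"
  \<comment> \<open>Negation reverses order, so the list is also read backwards to remain
    increasing.\<close>
  define reflect where "reflect = (\<lambda>(f :: nat \<Rightarrow> int) k. - 1 - f (n - 1 - k))"
  have mono: "strict_mono_on {..<n} (reflect f)" if "strict_mono_on {..<n} f" for f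
    using that by (auto simp: reflect_def strict_mono_on_def)
  \<comment> \<open>\<open>c\<close> now selects rows and \<open>r\<close> columns, since the flip
    exchanges the two.\<close>
  let ?N = "mat n n (\<lambda>(k, l). M (reflect c k) (reflect r l))"
  have "0 \<le> det ?N"
    using assms mono[OF r] mono[OF c] by (simp add: totally_positive_def)
  also have "\<dots> = det (flip_mat ?N)"
    by (rule det_flip_mat[of _ n, symmetric]) simp
  also have "flip_mat ?N = mat n n (\<lambda>(k, l). flip_int M (r k) (c l))"
    by (rule eq_matI) (auto simp: flip_mat_def flip_int_def reflect_def)
  finally show "0 \<le> det (mat n n (\<lambda>(k, l). flip_int M (r k) (c l)))" .
qed

lemma flip_int_flip_int [simp]: "flip_int (flip_int M) = M"
  by (simp add: flip_int_def fun_eq_iff)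

lemma totally_positive_flip_int_iff: "totally_positive (flip_int M) \<longleftrightarrow> totally_positive M"
  using totally_positive_flip_int[of M] totally_positive_flip_int[of "flip_int M"] by auto

text \<open>Uniqueness of quotient and remainder: the claimed remainder lies in the range from 0 to
  \<open>p - 1\<close>.\<close>

lemma div_mod_reflect:
  fixes u p :: int
  assumes "p > 0"
  shows "(- 1 - u) div p = - 1 - u div p" and "(- 1 - u) mod p = p - 1 - u mod p"
proof -
  have "- 1 - u = p * (- 1 - u div p) + (p - 1 - u mod p)"
    using mult_div_mod_eq[of p u] by (simp add: algebra_simps)
  moreover have "0 \<le> p - 1 - u mod p" "p - 1 - u mod p < p"
    using assms pos_mod_bound[of p u] pos_mod_sign[of p u] by linarith+
  ultimately show "(- 1 - u) div p = - 1 - u div p" "(- 1 - u) mod p = p - 1 - u mod p"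
    using int_div_pos_eq int_mod_pos_eq by metis+
qed

lemma lace_flip_mat:
  assumes p: "p \<ge> 1" and q: "q \<ge> 1" and A: "A \<in> carrier_mat p q"
  shows "lace (flip_mat A) = flip_int (lace A)"
proof (intro ext)
  fix v u :: int
  define i where "i = nat (u mod int p)"
  define j where "j = nat (v mod int q)"
  have i: "i < p" "u mod int p = int i" and j: "j < q" "v mod int q = int j"
    using p q by (simp_all add: i_def j_def nat_less_iff)
  \<comment> \<open>These turn the reflected integer residues into the natural-number indices used
    by \<open>flip_mat\<close>.\<close>
  have rows: "nat (int p - 1 - int i) = p - 1 - i" and cols: "nat (int q - 1 - int j) = q - 1 - j"
    by linarith+
  show "lace (flip_mat A) v u = flip_int (lace A) v u"
    using p q A i j by (simp add: lace_def flip_int_def div_mod_reflect flip_mat_def rows cols)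
qed

theorem theorem4p1:
  fixes A :: "real fps mat" and p q :: nat
  assumes "p \<ge> 1" and "q \<ge> 1" and "A \<in> carrier_mat p q"
  shows "lace (flip_mat A) = flip_int (lace A)
    \<and> (fully_interlacing (flip_mat A) \<longleftrightarrow> fully_interlacing A)"
  using lace_flip_mat[OF assms]
  by (simp add: fully_interlacing_def totally_positive_flip_int_iff)

end
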